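(* Let $n\ge1$ and $\alpha\in[0,1]$. The explicit fair mechanism $\mathrm{EM}$ of size $n$ with parameter $\alpha$ is an $\alpha$-differentially private mechanism which satisfies all seven properties RH, RM, CH, CM, F, WH and S, and it minimizes $\mathbb{L}_0$ among all $\alpha$-differentially private mechanisms of size $n$ satisfying all seven of these properties.
   Context: Write $[n]=\{0,1,\dots,n\}$. A mechanism of size $n$ is an $(n+1)\times(n+1)$ column-stochastic real matrix $\mathcal P$ with rows (outputs) and columns (inputs) indexed by $[n]$; its entry in row $i$, column $j$ is written $\Pr[i|j]$, so $\Pr[i|j]\ge 0$ and $\sum_{i}\Pr[i|j]=1$ for each $j$. It is $\alpha$-differentially private if $\Pr[i|j]\ge\alpha\Pr[i|j+1]$ and $\Pr[i|j+1]\ge\alpha\Pr[i|j]$ for all $i\in[n]$, $0\le j\le n-1$. $\mathbb{L}_0(\mathcal P)=\frac{n+1}{n}-\frac{\operatorname{trace}(\mathcal P)}{n}$. Properties: - Row Honesty (RH): $\Pr[i|i]\ge\Pr[i|j]$ for all $i,j$. - Row Monotone (RM): $\Pr[i|j-1]\le\Pr[i|j]$ for all $1\le j\le i$, and $\Pr[i|j+1]\le\Pr[i|j]$ for all $i\le j<n$. - Column Honesty (CH): $\Pr[j|j]\ge\Pr[i|j]$ for all $i,j$. - Column Monotone (CM): $\Pr[i-1|j]\le\Pr[i|j]$ for all $1\le i\le j$, and $\Pr[i+1|j]\le\Pr[i|j]$ for all $j\le i<n$. - Fairness (F): $\Pr[i|i]=\Pr[j|j]$ for all $i,j$. - Weak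 Honesty (WH): $\Pr[i|i]\ge\frac1{n+1}$ for all $i$. - Symmetry (S): $\Pr[i|j]=\Pr[n-i|n-j]$ for all $i,j$. $\mathrm{EM}$ is defined (with $0^0=1$) by $\Pr[i|j]=y\,\alpha^{|i-j|}$ if $|i-j|<\min(j,n-j)$, and $\Pr[i|j]=y\,\alpha^{\lceil (|i-j|+\min(j,n-j))/2\rceil}$ otherwise, where $y$ is the normalizing constant $$y=\Big(1+2\sum_{k=1}^{n/2}\alpha^k\Big)^{-1}\ (n\text{ even}),\qquad y=\Big(1+2\sum_{k=1}^{(n-1)/2}\alpha^k+\alpha^{(n+1)/2}\Big)^{-1}\ (n\text{ odd}).$$ For $n$ even and $\alpha<1$ this is $y=\frac{1-\alpha}{1+\alpha-2\alpha^{n/2+1}}$. *)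

theory Defs
  imports Complex_Main "Jordan_Normal_Form.Matrix"
begin

text \<open>Rows and columns are numbered \<open>0, \<dots>, n\<close>, as in the library's matrices;
  the entry \<open>P $$ (i, j)\<close> is the probability of output \<open>i\<close> on input \<open>j\<close>.\<close>

definition mechanism :: "nat \<Rightarrow> real mat \<Rightarrow> bool" where
  "mechanism n P \<longleftrightarrow> P \<in> carrier_mat (n + 1) (n + 1) \<and>
     (\<forall>i\<le>n. \<forall>j\<le>n. P $$ (i, j) \<ge> 0) \<and>
     (\<forall>j\<le>n. (\<Sum>i\<le>n. P $$ (i, j)) = 1)"

definition differentially_private :: "real \<Rightarrow> nat \<Rightarrow> real mat \<Rightarrow> bool" where
  "differentially_private \<alpha> n P \<longleftrightarrow>
     (\<forall>i\<le>n. \<forall>j<n. P $$ (i, j) \<ge> \<alpha> * P $$ (i, j + 1) \<and>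
                    P $$ (i, j + 1) \<ge> \<alpha> * P $$ (i, j))"

definition mat_trace :: "'a :: comm_monoid_add mat \<Rightarrow> 'a" where
  "mat_trace A = (\<Sum>i<dim_row A. A $$ (i, i))"

definition L0 :: "nat \<Rightarrow> real mat \<Rightarrow> real" where
  "L0 n P = (real n + 1) / real n - mat_trace P / real n"

definition row_honest :: "nat \<Rightarrow> real mat \<Rightarrow> bool" where
  "row_honest n P \<longleftrightarrow> (\<forall>i\<le>n. \<forall>j\<le>n. P $$ (i, i) \<ge> P $$ (i, j))"

definition row_monotone :: "nat \<Rightarrow> real mat \<Rightarrow> bool" where
  "row_monotone n P \<longleftrightarrow>
     (\<forall>i\<le>n. (\<forall>j. 1 \<le> j \<and> j \<le> i \<longrightarrow> P $$ (i, j - 1) \<le> P $$ (i, j)) \<and>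
             (\<forall>j. i \<le> j \<and> j < n \<longrightarrow> P $$ (i, j + 1) \<le> P $$ (i, j)))"

definition column_honest :: "nat \<Rightarrow> real mat \<Rightarrow> bool" where
  "column_honest n P \<longleftrightarrow> (\<forall>i\<le>n. \<forall>j\<le>n. P $$ (j, j) \<ge> P $$ (i, j))"

definition column_monotone :: "nat \<Rightarrow> real mat \<Rightarrow> bool" where
  "column_monotone n P \<longleftrightarrow>
     (\<forall>j\<le>n. (\<forall>i. 1 \<le> i \<and> i \<le> j \<longrightarrow> P $$ (i - 1, j) \<le> P $$ (i, j)) \<and>
             (\<forall>i. j \<le> i \<and> i < n \<longrightarrow> P $$ (i + 1, j) \<le> P $$ (i, j)))"

definition fair :: "nat \<Rightarrow> real mat \<Rightarrow> bool" where
  "fair n P \<longleftrightarrow> (\<forall>i\<le>n. \<forall>j\<le>n. P $$ (i, i) = P $$ (j, j))"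

definition weakly_honest :: "nat \<Rightarrow> real mat \<Rightarrow> bool" where
  "weakly_honest n P \<longleftrightarrow> (\<forall>i\<le>n. P $$ (i, i) \<ge> 1 / (real n + 1))"

definition symmetric :: "nat \<Rightarrow> real mat \<Rightarrow> bool" where
  "symmetric n P \<longleftrightarrow> (\<forall>i\<le>n. \<forall>j\<le>n. P $$ (i, j) = P $$ (n - i, n - j))"

definition all_properties :: "nat \<Rightarrow> real mat \<Rightarrow> bool" where
  "all_properties n P \<longleftrightarrow> row_honest n P \<and> row_monotone n P \<and> column_honest n P \<and>
     column_monotone n P \<and> fair n P \<and> weakly_honest n P \<and> symmetric n P"

definition EM_const :: "nat \<Rightarrow> real \<Rightarrow> real" where
  "EM_const n \<alpha> =
     (if even n then inverse (1 + 2 * (\<Sum>k = 1..n div 2. \<alpha> ^ k))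
      else inverse (1 + 2 * (\<Sum>k = 1..(n - 1) div 2. \<alpha> ^ k) + \<alpha> ^ ((n + 1) div 2)))"

text \<open>Powers have natural exponents, so that \<open>0 ^ 0 = 1\<close>.\<close>

definition EM_exponent :: "nat \<Rightarrow> nat \<Rightarrow> nat \<Rightarrow> nat" where
  "EM_exponent n i j =
     (let d = nat \<bar>int i - int j\<bar>; m = min j (n - j)
      in if d < m then d else nat \<lceil>(real d + real m) / 2\<rceil>)"

definition EM :: "nat \<Rightarrow> real \<Rightarrow> real mat" where
  "EM n \<alpha> = mat (n + 1) (n + 1) (\<lambda>(i, j). EM_const n \<alpha> * \<alpha> ^ EM_exponent n i j)"

end

theory Submission
  imports Defs
begin

text \<open>Every column of EM carries the same multiset of exponents
  \<open>\<lceil>0/2\<rceil>, \<lceil>1/2\<rceil>, \<dots>, \<lceil>n/2\<rceil>\<close>: in column \<open>j \<le> n div 2\<close> the rows \<open>i > 2 * j\<close> have exponent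
  \<open>\<lceil>i/2\<rceil>\<close>, and the rows \<open>i \<le> 2 * j\<close> rearrange the first \<open>2 * j + 1\<close> of these numbers. In the middle
  column the exponent is the distance to the diagonal. For a fair private mechanism with
  diagonal entry \<open>f\<close>, privacy along the rows bounds the middle column from below by
  \<open>f * \<alpha> ^ \<bar>i - j\<bar>\<close>; as that column sums to 1, \<open>f\<close> is at most the constant of EM.\<close>

section \<open>Exponents of the entries of \<open>EM\<close>\<close>

lemma nat_ceiling_half: "nat \<lceil>(real d + real m) / 2\<rceil> = (d + m + 1) div 2"
proof -
  have "\<lceil>(real d + real m) / 2\<rceil> = int ((d + m + 1) div 2)"
    by (rule ceiling_unique) (cases "even (d + m)"; auto elim!: evenE oddE)+
  then show ?thesis by simp
qed

text \<open>With distance to the diagonal \<open>d\<close> and distance to the nearer border column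
  \<open>m\<close> as independent arguments, comparing exponents becomes linear arithmetic on
  naturals.\<close>

definition EM_level :: "nat \<Rightarrow> nat \<Rightarrow> nat" where
  "EM_level d m = (if d < m then d else (d + m + 1) div 2)"

lemma EM_exponent_alt:
  "EM_exponent n i j = EM_level (nat \<bar>int i - int j\<bar>) (min j (n - j))"
  by (simp only: EM_exponent_def EM_level_def Let_def nat_ceiling_half)

text \<open>Raising both arguments by at most 1 adds at most 2 to \<open>d + m\<close>, hence at
  most 1 to the rounded half. Privacy of \<open>EM\<close> rests on this.\<close>

lemma EM_level_le_Suc:
  assumes "d \<le> Suc d'" "m \<le> Suc m'"
  shows "EM_level d m \<le> Suc (EM_level d' m')"
  using assms unfolding EM_level_def by (simp split: if_splits; linarith)

text \<open>A step away from the diagonal raises \<open>d\<close> by 1 while \<open>m\<close> drops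
  by at most 1, so \<open>d + m\<close> does not decrease. The bound \<open>m' \<le> Suc m\<close>
  rules out a return to the branch \<open>d < m\<close>.\<close>

lemma EM_level_Suc_mono:
  assumes "m \<le> Suc m'" "m' \<le> Suc m"
  shows "EM_level d m \<le> EM_level (Suc d) m'"
  using assms unfolding EM_level_def by (simp split: if_splits; linarith)

lemma EM_level_mono: "d \<le> d' \<Longrightarrow> EM_level d m \<le> EM_level d' m"
  unfolding EM_level_def by (simp split: if_splits; linarith)

text \<open>At \<open>d = m\<close> and \<open>d = m + 1\<close> the rounded half is again
  \<open>d\<close>, so the linear regime reaches two steps beyond the branch condition.\<close>

lemma EM_level_below: "d \<le> Suc m \<Longrightarrow> EM_level d m = d"
  unfolding EM_level_def by (simp split: if_splits; linarith)

lemma EM_exponent_diag [simp]: "EM_exponent n i i = 0"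
  by (simp add: EM_exponent_alt EM_level_def)

lemma EM_exponent_reflect:
  assumes "i \<le> n" "j \<le> n"
  shows "EM_exponent n (n - i) (n - j) = EM_exponent n i j"
proof -
  have "nat \<bar>int (n - i) - int (n - j)\<bar> = nat \<bar>int i - int j\<bar>"
    "min (n - j) (n - (n - j)) = min j (n - j)"
    using assms by auto
  then show ?thesis by (simp only: EM_exponent_alt)
qed

lemma EM_exponent_middle:
  assumes "i \<le> n"
  shows "EM_exponent n i (n div 2) = nat \<bar>int i - int (n div 2)\<bar>"
proof -
  have "min (n div 2) (n - n div 2) = n div 2" by linarith
  \<comment> \<open>For odd \<open>n\<close> the last row attains distance
    \<open>n div 2 + 1\<close>, the extreme case of \<open>EM_level_below\<close>.\<close>
  moreover have "nat \<bar>int i - int (n div 2)\<bar> \<le> Suc (n div 2)" using assms by linarith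
  ultimately show ?thesis by (simp only: EM_exponent_alt EM_level_below)
qed

text \<open>Here \<open>d = i - j\<close> and \<open>m = j\<close>, so \<open>d + m = i\<close> and
  the column index cancels.\<close>

lemma EM_exponent_left_outer:
  assumes "2 * j \<le> i" "i \<le> n"
  shows "EM_exponent n i j = (i + 1) div 2"
proof -
  have "min j (n - j) = j" "nat \<bar>int i - int j\<bar> = i - j" using assms by auto
  then show ?thesis using assms by (simp add: EM_exponent_alt EM_level_def)
qed

lemma EM_exponent_left_inner:
  assumes "i \<le> 2 * j" "2 * j \<le> n"
  shows "EM_exponent n i j = nat \<bar>int i - int j\<bar>"
proof -
  have "min j (n - j) = j" "nat \<bar>int i - int j\<bar> \<le> Suc j" using assms by auto
  then show ?thesis by (simp only: EM_exponent_alt EM_level_below)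
qed

lemma EM_exponent_row_step:
  assumes "j < n"
  shows "EM_exponent n i j \<le> Suc (EM_exponent n i (j + 1))"
    and "EM_exponent n i (j + 1) \<le> Suc (EM_exponent n i j)"
    and "j < i \<Longrightarrow> EM_exponent n i (j + 1) \<le> EM_exponent n i j"
    and "i \<le> j \<Longrightarrow> EM_exponent n i j \<le> EM_exponent n i (j + 1)"
proof -
  let ?d = "nat \<bar>int i - int j\<bar>" and ?d' = "nat \<bar>int i - int (j + 1)\<bar>"
  let ?m = "min j (n - j)" and ?m' = "min (j + 1) (n - (j + 1))"
  have m: "?m \<le> Suc ?m'" "?m' \<le> Suc ?m" using assms by auto
  have d: "?d \<le> Suc ?d'" "?d' \<le> Suc ?d" by auto
  show "EM_exponent n i j \<le> Suc (EM_exponent n i (j + 1))"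
    and "EM_exponent n i (j + 1) \<le> Suc (EM_exponent n i j)"
    unfolding EM_exponent_alt by (intro EM_level_le_Suc m d)+
  show "EM_exponent n i (j + 1) \<le> EM_exponent n i j" if "j < i"
  proof -
    have "?d = Suc ?d'" using that by linarith
    then show ?thesis unfolding EM_exponent_alt by (simp only: EM_level_Suc_mono m)
  qed
  show "EM_exponent n i j \<le> EM_exponent n i (j + 1)" if "i \<le> j"
  proof -
    have "?d' = Suc ?d" using that by linarith
    then show ?thesis unfolding EM_exponent_alt by (simp only: EM_level_Suc_mono m)
  qed
qed

lemma EM_exponent_column_mono:
  assumes "\<bar>int i - int j\<bar> \<le> \<bar>int i' - int j\<bar>"
  shows "EM_exponent n i j \<le> EM_exponent n i' j"
proof -
  have "nat \<bar>int i - int j\<bar> \<le> nat \<bar>int i' - int j\<bar>" using assms by linarith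
  then show ?thesis unfolding EM_exponent_alt by (rule EM_level_mono)
qed

section \<open>Column sums of powers\<close>

lemma sum_power_distance:
  fixes x :: "'a :: comm_semiring_1"
  shows "(\<Sum>i\<le>2 * j. x ^ nat \<bar>int i - int j\<bar>) = (\<Sum>i\<le>2 * j. x ^ ((i + 1) div 2))"
proof (induction j)
  case 0
  then show ?case by simp
next
  case (Suc j)
  \<comment> \<open>Row 0 contributes \<open>x ^ Suc j\<close>; shifting the remaining rows by one
    recentres them at \<open>j\<close>. The new last row then gives the second
    \<open>x ^ Suc j\<close>.\<close>
  have "(\<Sum>i\<le>2 * Suc j. x ^ nat \<bar>int i - int (Suc j)\<bar>) =
      (\<Sum>i\<le>Suc (2 * j). x ^ nat \<bar>int i - int j\<bar>) + x ^ Suc j"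
    by (simp add: sum.atMost_Suc_shift nat_add_distrib add.commute del: sum.atMost_Suc power_Suc)
  also have "\<dots> = (\<Sum>i\<le>2 * j. x ^ nat \<bar>int i - int j\<bar>) + x ^ Suc j + x ^ Suc j"
    by (simp add: nat_add_distrib add.commute)
  also have "\<dots> = (\<Sum>i\<le>2 * Suc j. x ^ ((i + 1) div 2))"
    by (simp add: Suc.IH)
  finally show ?case .
qed

lemma sum_power_EM_exponent_left:
  fixes x :: "'a :: comm_semiring_1"
  assumes "2 * j \<le> n"
  shows "(\<Sum>i\<le>n. x ^ EM_exponent n i j) = (\<Sum>i\<le>n. x ^ ((i + 1) div 2))"
proof -
  have split: "{..n} = {..2 * j} \<union> {2 * j<..n}" using assms by auto
  have "(\<Sum>i\<le>2 * j. x ^ EM_exponent n i j) = (\<Sum>i\<le>2 * j. x ^ ((i + 1) div 2))"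
    unfolding sum_power_distance [symmetric]
    using assms by (intro sum.cong) (simp_all add: EM_exponent_left_inner)
  moreover have "(\<Sum>i\<in>{2 * j<..n}. x ^ EM_exponent n i j) = (\<Sum>i\<in>{2 * j<..n}. x ^ ((i + 1) div 2))"
    by (intro sum.cong) (simp_all add: EM_exponent_left_outer)
  ultimately show ?thesis
    unfolding split by (subst (1 2) sum.union_disjoint) auto
qed

lemma sum_power_EM_exponent:
  fixes x :: "'a :: comm_semiring_1"
  assumes "j \<le> n"
  shows "(\<Sum>i\<le>n. x ^ EM_exponent n i j) = (\<Sum>i\<le>n. x ^ ((i + 1) div 2))"
proof (cases "2 * j \<le> n")
  case True
  then show ?thesis by (rule sum_power_EM_exponent_left)
next
  case False
  \<comment> \<open>Reversing the rows turns a column right of the middle into its mirror image on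
    the left.\<close>
  have "(\<Sum>i\<le>n. x ^ EM_exponent n i j) = (\<Sum>i\<le>n. x ^ EM_exponent n (n - i) j)"
    by (rule sum.reindex_bij_witness [where i = "\<lambda>i. n - i" and j = "\<lambda>i. n - i"]) auto
  also have "\<dots> = (\<Sum>i\<le>n. x ^ EM_exponent n i (n - j))"
  proof (intro sum.cong refl)
    fix i assume "i \<in> {..n}"
    then show "x ^ EM_exponent n (n - i) j = x ^ EM_exponent n i (n - j)"
      using EM_exponent_reflect [of i n "n - j"] assms by simp
  qed
  also have "\<dots> = (\<Sum>i\<le>n. x ^ ((i + 1) div 2))"
    using False by (intro sum_power_EM_exponent_left) simp
  finally show ?thesis .
qed

section \<open>The normalizing constant\<close>

lemma sum_power_half_even:
  fixes x :: "'a :: comm_semiring_1"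
  shows "(\<Sum>i\<le>2 * k. x ^ ((i + 1) div 2)) = 1 + 2 * (\<Sum>i=1..k. x ^ i)"
  by (induction k) (simp_all add: algebra_simps mult_2)

text \<open>This removes the parity cases: the sum runs over the exponents common to all columns.
  For odd \<open>n\<close> the top exponent \<open>(n + 1) div 2\<close> occurs only once, hence the
  unpaired term in \<open>EM_const\<close>.\<close>

lemma EM_const_eq: "EM_const n \<alpha> = inverse (\<Sum>i\<le>n. \<alpha> ^ ((i + 1) div 2))"
proof (cases "even n")
  case True
  then obtain k where "n = 2 * k" by blast
  then show ?thesis by (simp add: EM_const_def sum_power_half_even del: One_nat_def)
next
  case False
  then obtain k where n: "n = 2 * k + 1" by (blast elim: oddE)
  then have "(\<Sum>i\<le>n. \<alpha> ^ ((i + 1) div 2)) = 1 + 2 * (\<Sum>i=1..k. \<alpha> ^ i) + \<alpha> ^ (k + 1)"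
    using sum_power_half_even [of \<alpha> k] by simp
  then show ?thesis using n by (simp add: EM_const_def)
qed

text \<open>The term at \<open>i = 0\<close> is 1 even for \<alpha> = 0, so the sum can be
  inverted.\<close>

lemma sum_power_half_ge_1:
  fixes \<alpha> :: real
  assumes "0 \<le> \<alpha>"
  shows "1 \<le> (\<Sum>i\<le>n. \<alpha> ^ ((i + 1) div 2))"
  using member_le_sum [of 0 "{..n}" "\<lambda>i. \<alpha> ^ ((i + 1) div 2)"] assms by simp

lemma EM_const_pos:
  assumes "0 \<le> \<alpha>"
  shows "0 < EM_const n \<alpha>"
  using sum_power_half_ge_1 [OF assms, of n] by (simp add: EM_const_eq)

lemma EM_const_ge_uniform:
  assumes "0 \<le> \<alpha>" "\<alpha> \<le> 1"
  shows "1 / (real n + 1) \<le> EM_const n \<alpha>"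
proof -
  have "(\<Sum>i\<le>n. \<alpha> ^ ((i + 1) div 2)) \<le> (\<Sum>i\<le>n. 1)"
    using assms by (intro sum_mono power_le_one)
  then have "(\<Sum>i\<le>n. \<alpha> ^ ((i + 1) div 2)) \<le> real n + 1" by simp
  then show ?thesis
    using sum_power_half_ge_1 [OF assms(1), of n] by (simp add: EM_const_eq divide_simps)
qed

section \<open>Privacy and the seven properties of \<open>EM\<close>\<close>

lemma EM_index [simp]:
  "i \<le> n \<Longrightarrow> j \<le> n \<Longrightarrow> EM n \<alpha> $$ (i, j) = EM_const n \<alpha> * \<alpha> ^ EM_exponent n i j"
  by (simp add: EM_def)

lemma mechanism_EM:
  assumes "0 \<le> \<alpha>"
  shows "mechanism n (EM n \<alpha>)"
proof -
  have "(\<Sum>i\<le>n. EM n \<alpha> $$ (i, j)) = 1" if "j \<le> n" for j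
  proof -
    have "(\<Sum>i\<le>n. EM n \<alpha> $$ (i, j)) = EM_const n \<alpha> * (\<Sum>i\<le>n. \<alpha> ^ EM_exponent n i j)"
      using that by (simp add: sum_distrib_left)
    then show ?thesis
      using sum_power_half_ge_1 [OF assms, of n]
      by (simp add: sum_power_EM_exponent [OF that] EM_const_eq)
  qed
  moreover have "EM n \<alpha> \<in> carrier_mat (n + 1) (n + 1)" by (simp add: EM_def)
  ultimately show ?thesis
    using assms less_imp_le [OF EM_const_pos [OF assms]] by (simp add: mechanism_def)
qed

lemma EM_entry_le:
  assumes "0 \<le> \<alpha>" "\<alpha> \<le> 1" "e \<le> e'"
  shows "EM_const n \<alpha> * \<alpha> ^ e' \<le> EM_const n \<alpha> * \<alpha> ^ e"
  using assms EM_const_pos [OF assms(1), of n] by (simp add: power_decreasing)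

lemma differentially_private_EM:
  assumes "0 \<le> \<alpha>" "\<alpha> \<le> 1"
  shows "differentially_private \<alpha> n (EM n \<alpha>)"
  unfolding differentially_private_def
proof (intro allI impI conjI)
  fix i j assume ij: "i \<le> n" "j < n"
  show "EM n \<alpha> $$ (i, j) \<ge> \<alpha> * EM n \<alpha> $$ (i, j + 1)"
    \<comment> \<open>The factor \<alpha> is absorbed into the power as one more unit of
      exponent.\<close>
    using EM_entry_le [OF assms EM_exponent_row_step(1) [OF ij(2)], of n i] ij
    by (simp add: mult.left_commute)
  show "EM n \<alpha> $$ (i, j + 1) \<ge> \<alpha> * EM n \<alpha> $$ (i, j)"
    using EM_entry_le [OF assms EM_exponent_row_step(2) [OF ij(2)], of n i] ij
    by (simp add: mult.left_commute)
qed

lemma all_properties_EM: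
  assumes "0 \<le> \<alpha>" "\<alpha> \<le> 1"
  shows "all_properties n (EM n \<alpha>)"
proof -
  note le = EM_entry_le [OF assms]
  \<comment> \<open>The diagonal exponent is 0, the least possible.\<close>
  have rh: "row_honest n (EM n \<alpha>)" and ch: "column_honest n (EM n \<alpha>)"
    unfolding row_honest_def column_honest_def using le [of 0] by simp_all
  have rm: "row_monotone n (EM n \<alpha>)"
    unfolding row_monotone_def
  proof (intro allI impI conjI)
    fix i j assume "i \<le> n" and j: "1 \<le> j \<and> j \<le> i"
    then have "j - 1 < n" "j - 1 < i" "j - 1 + 1 = j" by auto
    then show "EM n \<alpha> $$ (i, j - 1) \<le> EM n \<alpha> $$ (i, j)"
      using EM_exponent_row_step(3) [of "j - 1" n i] \<open>i \<le> n\<close> j by (simp add: le)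
  next
    fix i j assume "i \<le> n" "i \<le> j \<and> j < n"
    then show "EM n \<alpha> $$ (i, j + 1) \<le> EM n \<alpha> $$ (i, j)"
      using EM_exponent_row_step(4) [of j n i] by (simp add: le)
  qed
  have cm: "column_monotone n (EM n \<alpha>)"
    unfolding column_monotone_def by (auto intro!: le EM_exponent_column_mono)
  have f: "fair n (EM n \<alpha>)" by (simp add: fair_def)
  have wh: "weakly_honest n (EM n \<alpha>)"
    using EM_const_ge_uniform [OF assms] by (simp add: weakly_honest_def)
  have s: "symmetric n (EM n \<alpha>)" by (simp add: symmetric_def EM_exponent_reflect)
  show ?thesis using rh rm ch cm f wh s by (simp add: all_properties_def)
qed

section \<open>Optimality among fair private mechanisms\<close>

lemma differentially_private_power:
  assumes dp: "differentially_private \<alpha> n P" and "0 \<le> \<alpha>" and "i \<le> n" "j \<le> n"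
  shows "\<alpha> ^ nat \<bar>int i - int j\<bar> * P $$ (i, i) \<le> P $$ (i, j)"
proof -
  \<comment> \<open>Walking away from the diagonal along row \<open>i\<close>, each step costs one
    factor \<alpha>; the two directions use the two privacy inequalities.\<close>
  have right: "\<alpha> ^ k * P $$ (i, i) \<le> P $$ (i, i + k)" if "i + k \<le> n" for k
    using that
  proof (induction k)
    case (Suc k)
    then have "\<alpha> * (\<alpha> ^ k * P $$ (i, i)) \<le> \<alpha> * P $$ (i, i + k)"
      using assms(2) by (intro mult_left_mono) auto
    also have "\<dots> \<le> P $$ (i, i + Suc k)"
      using dp assms(3) Suc.prems by (simp add: differentially_private_def)
    finally show ?case by (simp add: mult.assoc)
  qed simp
  have left: "\<alpha> ^ k * P $$ (i, i) \<le> P $$ (i, i - k)" if "k \<le> i" for k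
    using that
  proof (induction k)
    case (Suc k)
    then have "\<alpha> * (\<alpha> ^ k * P $$ (i, i)) \<le> \<alpha> * P $$ (i, i - Suc k + 1)"
      using assms(2) by (intro mult_left_mono) (auto simp: Suc_diff_Suc)
    also have "\<dots> \<le> P $$ (i, i - Suc k)"
      using dp assms(3) Suc.prems unfolding differentially_private_def
      by (metis Suc_le_lessD diff_less less_le_trans zero_less_Suc gr_implies_not0 not_gr_zero)
    finally show ?case by (simp add: mult.assoc)
  qed simp
  show ?thesis
  proof (cases "i \<le> j")
    case True
    then have "nat \<bar>int i - int j\<bar> = j - i" by linarith
    then show ?thesis using right [of "j - i"] True assms(4) by simp
  next
    case False
    then have "nat \<bar>int i - int j\<bar> = i - j" by linarith
    then show ?thesis using left [of "i - j"] False by simp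
  qed
qed

lemma fair_diagonal_le_EM_const:
  assumes P: "mechanism n P" "differentially_private \<alpha> n P" "fair n P"
    and "0 \<le> \<alpha>" "i \<le> n"
  shows "P $$ (i, i) \<le> EM_const n \<alpha>"
proof -
  let ?S = "\<Sum>l\<le>n. \<alpha> ^ ((l + 1) div 2)"
  let ?j = "n div 2"
  have "P $$ (i, i) * ?S = (\<Sum>l\<le>n. \<alpha> ^ EM_exponent n l ?j * P $$ (i, i))"
    by (subst sum_power_EM_exponent [of ?j n \<alpha>, symmetric]) (simp_all add: sum_distrib_left mult.commute)
  also have "\<dots> \<le> (\<Sum>l\<le>n. P $$ (l, ?j))"
  proof (rule sum_mono)
    fix l assume "l \<in> {..n}"
    \<comment> \<open>Privacy along row \<open>l\<close> bounds the entry by the diagonal entry of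
      that row; fairness replaces it by one common value.\<close>
    moreover from this have "P $$ (i, i) = P $$ (l, l)"
      using P(3) \<open>i \<le> n\<close> unfolding fair_def by blast
    ultimately show "\<alpha> ^ EM_exponent n l ?j * P $$ (i, i) \<le> P $$ (l, ?j)"
      using differentially_private_power [OF P(2) \<open>0 \<le> \<alpha>\<close>, of l ?j]
      by (simp add: EM_exponent_middle)
  qed
  also have "\<dots> = 1" using P(1) by (simp add: mechanism_def)
  finally show ?thesis
    using sum_power_half_ge_1 [OF \<open>0 \<le> \<alpha>\<close>, of n] by (simp add: EM_const_eq divide_simps)
qed

text \<open>\<open>L0\<close> decreases as the trace grows, and every diagonal entry of
  \<open>EM\<close> equals \<open>EM_const\<close>, the upper bound for a fair diagonal.\<close>

lemma L0_EM_le: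
  assumes "mechanism n P" "differentially_private \<alpha> n P" "fair n P" "0 \<le> \<alpha>"
  shows "L0 n (EM n \<alpha>) \<le> L0 n P"
proof -
  have dims: "dim_row P = Suc n" "dim_row (EM n \<alpha>) = Suc n"
    using assms(1) by (auto simp: mechanism_def EM_def)
  have "mat_trace P \<le> mat_trace (EM n \<alpha>)"
    unfolding mat_trace_def dims
    using fair_diagonal_le_EM_const [OF assms] by (intro sum_mono) simp
  then show ?thesis by (simp add: L0_def divide_right_mono)
qed

theorem theorem4:
  fixes n :: nat and \<alpha> :: real
  assumes "n \<ge> 1" and "0 \<le> \<alpha>" and "\<alpha> \<le> 1"
  shows "mechanism n (EM n \<alpha>) \<and> differentially_private \<alpha> n (EM n \<alpha>) \<and>
         all_properties n (EM n \<alpha>) \<and>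
         (\<forall>P. mechanism n P \<and> differentially_private \<alpha> n P \<and> all_properties n P
              \<longrightarrow> L0 n (EM n \<alpha>) \<le> L0 n P)"
  using mechanism_EM differentially_private_EM all_properties_EM L0_EM_le assms(2,3)
  by (auto simp: all_properties_def)

end
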